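(* Let $\Lambda=\{(V_i,\Lambda_i,v_i)\}_{i\in I}$ be a $g$-$p$-fusion frame for $X$ with respect to $\{X_i\}_{i\in I}$ with bounds $A,B$, and let $\Gamma=\{(W_i,\Gamma_i,v_i)\}_{i\in I}$ be a $g$-$p$-fusion frame for $Y$ with respect to $\{Y_i\}_{i\in I}$ with bounds $C,D$, where $\Gamma_i\in\mathcal B(Y,Y_i)$ for each $i\in I$. Then $\Lambda\oplus\Gamma=\{(V_i\oplus W_i,\Lambda_i\oplus\Gamma_i,v_i)\}_{i\in I}$ is a $g$-$p$-fusion frame for $X\oplus Y$ with respect to $\{X_i\oplus Y_i\}_{i\in I}$, and for all $f\in X$, $g\in Y$, $$\min(A^p,C^p)\,\|f\oplus g\|^p\le\sum_{i\in I}v_i^p\|(\Lambda_i\oplus\Gamma_i)P_{V_i\oplus W_i}(f\oplus g)\|^p\le\max(B^p,D^p)\,\|f\oplus g\|^p.$$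
   Context: $X,Y$ are separable Banach spaces over $\mathbb K$ ($\mathbb R$ or $\mathbb C$), $p\in(1,\infty)$, $I\subset\mathbb N$, $\{X_i\}_{i\in I}$ and $\{Y_i\}_{i\in I}$ are sequences of Banach spaces over $\mathbb K$, $\mathcal B(X,X_i)$ is the space of bounded linear operators from $X$ to $X_i$, and $v_i>0$ are weights. $V_i\subset X$ and $W_i\subset Y$ are closed subspaces, with fixed (as part of the data) non-trivial (nonzero) linear projections $P_{V_i}$ of $X$ onto $V_i$ and $P_{W_i}$ of $Y$ onto $W_i$. With $\Lambda_i\in\mathcal B(X,X_i)$, the family $\Lambda=\{(V_i,\Lambda_i,v_i)\}_{i\in I}$ is a $g$-$p$-fusion frame for $X$ with respect to $\{X_i\}_{i\in I}$ with bounds $A,B$, where $0<A\le B<\infty$, if $A\|f\|\le\big(\sum_{i\in I}v_i^p\|\Lambda_iP_{V_i}(f)\|^p\big)^{1/p}\le B\|f\|$ for all $f\in X$; it is called a $g$-$p$-fusion frame if such bounds exist. The same definition applies to $Y$ and to $X\oplus Y$. The Cartesian product $X\oplus Y$ is the Banach space of pairs $f\oplus g$ ($f\in X$, $g\in Y$) with norm given by $\|f\oplus g\|^p=\|f\|_X^p+\|g\|_Y^p$; likewise for $X_i\oplus Y_i$. For $U\in\mathcal B(X,X_i)$, $V\in\mathcal B(Y,Y_i)$, the operator $U\oplus V\in\mathcal B(X\oplus Y,X_i\oplus Y_i)$ is $(U\oplus V)(f\oplus g)=Uf\oplus Vg$, and $P_{V_i\oplus W_i}(f\oplus g)=P_{V_i}f\oplus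 P_{W_i}g$. *)

theory Defs
  imports "HOL-Analysis.Analysis" "HOL-Algebra.Module"
begin

text \<open>
  Normed spaces carry an explicit carrier set, so that a family \<open>X\<^sub>i\<close> may consist of unrelated
  spaces (with unrelated operations and norms), and so that a direct sum can be given the
  \<open>p\<close>-norm, which is not the norm of the type class instance for products.

  The scalar field is a type of class \<^class>\<open>real_normed_field\<close>.  The types \<^typ>\<open>real\<close> and
  \<^typ>\<open>complex\<close> are instances; by the Gelfand-Mazur theorem every instance is
  isometrically isomorphic to one of these two.
\<close>

definition scalars :: "'k::real_normed_field ring" where
  "scalars = \<lparr>carrier = UNIV, mult = (*), one = 1, zero = 0, add = (+)\<rparr>"

text \<open>
  As for every \<open>module\<close> record of HOL-Algebra, the fields \<open>mult\<close> and \<open>one\<close> of a normed space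
  are inherited from rings and are subject to no axiom.
\<close>

record ('k, 'x) normed_module = "('k, 'x) module" +
  vnorm :: "'x \<Rightarrow> real"

locale normed_space = module scalars X
  for X :: "('k::real_normed_field, 'x, 'm) normed_module_scheme" (structure) +
  assumes vnorm_eq_0_iff: "x \<in> carrier X \<Longrightarrow> vnorm X x = 0 \<longleftrightarrow> x = \<zero>\<^bsub>X\<^esub>"
    and vnorm_smult: "x \<in> carrier X \<Longrightarrow> vnorm X (c \<odot>\<^bsub>X\<^esub> x) = norm c * vnorm X x"
    and vnorm_triangle:
      "\<lbrakk>x \<in> carrier X; y \<in> carrier X\<rbrakk> \<Longrightarrow> vnorm X (x \<oplus>\<^bsub>X\<^esub> y) \<le> vnorm X x + vnorm X y"

text \<open>
  The locale \<^locale>\<open>Metric_space\<close> demands nonnegativity and symmetry of the distance also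
  outside the carrier, hence the case distinction.
\<close>

definition vdist :: "('k, 'x, 'm) normed_module_scheme \<Rightarrow> 'x \<Rightarrow> 'x \<Rightarrow> real" where
  "vdist X x y = (if x \<in> carrier X \<and> y \<in> carrier X then vnorm X (x \<ominus>\<^bsub>X\<^esub> y) else 0)"

lemma (in normed_space) Metric_space_vdist: "Metric_space (carrier X) (vdist X)"
proof -
  have minus: "\<ominus>\<^bsub>X\<^esub> x = (-1) \<odot>\<^bsub>X\<^esub> x" if "x \<in> carrier X" for x
  proof -
    have "\<ominus>\<^bsub>scalars\<^esub> \<one>\<^bsub>scalars\<^esub> = (-1 :: 'k)"
      by (rule R.minus_equality) (auto simp: scalars_def)
    then show ?thesis
      using smult_l_minus[of "\<one>\<^bsub>scalars\<^esub>" x] that by simp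
  qed
  have norm_minus: "vnorm X (\<ominus>\<^bsub>X\<^esub> x) = vnorm X x" if "x \<in> carrier X" for x
    using that by (simp add: minus vnorm_smult)
  have nonneg: "0 \<le> vnorm X x" if "x \<in> carrier X" for x
    using vnorm_triangle[of x "\<ominus>\<^bsub>X\<^esub> x"] that vnorm_eq_0_iff[of "\<zero>\<^bsub>X\<^esub>"]
    by (simp add: norm_minus M.r_neg)
  show ?thesis
  proof
    fix x y
    show "0 \<le> vdist X x y"
      by (simp add: vdist_def nonneg)
    have "vnorm X (x \<ominus>\<^bsub>X\<^esub> y) = vnorm X (y \<ominus>\<^bsub>X\<^esub> x)" if "x \<in> carrier X" "y \<in> carrier X"
    proof -
      have "\<ominus>\<^bsub>X\<^esub> (x \<ominus>\<^bsub>X\<^esub> y) = y \<ominus>\<^bsub>X\<^esub> x"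
        using that by (simp add: a_minus_def M.minus_add M.a_comm)
      then show ?thesis
        using norm_minus[of "x \<ominus>\<^bsub>X\<^esub> y"] that by simp
    qed
    then show "vdist X x y = vdist X y x"
      by (simp add: vdist_def)
  next
    fix x y
    assume "x \<in> carrier X" "y \<in> carrier X"
    moreover from this have "x \<ominus>\<^bsub>X\<^esub> y = \<zero>\<^bsub>X\<^esub> \<longleftrightarrow> x = y"
      by (metis M.a_inv_closed M.minus_equality M.minus_minus M.r_neg a_minus_def)
    ultimately show "vdist X x y = 0 \<longleftrightarrow> x = y"
      by (simp add: vdist_def vnorm_eq_0_iff)
  next
    fix x y z
    assume xyz: "x \<in> carrier X" "y \<in> carrier X" "z \<in> carrier X"
    then have "x \<ominus>\<^bsub>X\<^esub> z = (x \<ominus>\<^bsub>X\<^esub> y) \<oplus>\<^bsub>X\<^esub> (y \<ominus>\<^bsub>X\<^esub> z)"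
      by (simp add: a_minus_def M.a_assoc M.r_neg1)
    with xyz show "vdist X x z \<le> vdist X x y + vdist X y z"
      by (simp add: vdist_def vnorm_triangle)
  qed
qed

abbreviation vtopology :: "('k, 'x, 'm) normed_module_scheme \<Rightarrow> 'x topology" where
  "vtopology X \<equiv> Metric_space.mtopology (carrier X) (vdist X)"

definition banach_space :: "('k::real_normed_field, 'x, 'm) normed_module_scheme \<Rightarrow> bool" where
  "banach_space X \<longleftrightarrow> normed_space X \<and> Metric_space.mcomplete (carrier X) (vdist X)"

definition closed_subspace ::
    "('k::real_normed_field, 'x, 'm) normed_module_scheme \<Rightarrow> 'x set \<Rightarrow> bool" where
  "closed_subspace X V \<longleftrightarrow> submodule V (scalars :: 'k ring) X \<and> closedin (vtopology X) V"

definition linear_map ::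
    "('k::real_normed_field, 'x, 'm) normed_module_scheme \<Rightarrow>
     ('k, 'y, 'n) normed_module_scheme \<Rightarrow> ('x \<Rightarrow> 'y) \<Rightarrow> bool" where
  "linear_map X Y T \<longleftrightarrow> T \<in> hom (add_monoid X) (add_monoid Y) \<and>
     (\<forall>c. \<forall>x\<in>carrier X. T (c \<odot>\<^bsub>X\<^esub> x) = c \<odot>\<^bsub>Y\<^esub> T x)"

definition bounded_operators ::
    "('k::real_normed_field, 'x, 'm) normed_module_scheme \<Rightarrow>
     ('k, 'y, 'n) normed_module_scheme \<Rightarrow> ('x \<Rightarrow> 'y) set" where
  "bounded_operators X Y =
     {T. linear_map X Y T \<and> (\<exists>K. \<forall>x\<in>carrier X. vnorm Y (T x) \<le> K * vnorm X x)}"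

text \<open>Projections are linear and idempotent; they are not assumed to be bounded.\<close>

definition projection_onto ::
    "('k::real_normed_field, 'x, 'm) normed_module_scheme \<Rightarrow> 'x set \<Rightarrow> ('x \<Rightarrow> 'x) \<Rightarrow> bool" where
  "projection_onto X V P \<longleftrightarrow>
     linear_map X X P \<and> P ` carrier X = V \<and> (\<forall>x\<in>carrier X. P (P x) = P x)"

definition g_p_fusion_family ::
    "('k::real_normed_field, 'x) normed_module \<Rightarrow> nat set \<Rightarrow> (nat \<Rightarrow> ('k, 'c) normed_module) \<Rightarrow>
     (nat \<Rightarrow> 'x set) \<Rightarrow> (nat \<Rightarrow> 'x \<Rightarrow> 'x) \<Rightarrow> (nat \<Rightarrow> 'x \<Rightarrow> 'c) \<Rightarrow> (nat \<Rightarrow> real) \<Rightarrow> bool" where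
  "g_p_fusion_family X I Xs V P \<Lambda> v \<longleftrightarrow>
     banach_space X \<and> separable_space (vtopology X) \<and>
     (\<forall>i\<in>I. banach_space (Xs i) \<and> closed_subspace X (V i) \<and>
        projection_onto X (V i) (P i) \<and> (\<exists>x\<in>carrier X. P i x \<noteq> \<zero>\<^bsub>X\<^esub>) \<and>
        \<Lambda> i \<in> bounded_operators X (Xs i) \<and> v i > 0)"

text \<open>
  Summability is stated explicitly, since \<^const>\<open>infsum\<close> is \<open>0\<close> for a family that is not
  summable.
\<close>

definition g_p_fusion_frame_bounds ::
    "real \<Rightarrow> ('k::real_normed_field, 'x) normed_module \<Rightarrow> nat set \<Rightarrow>
     (nat \<Rightarrow> ('k, 'c) normed_module) \<Rightarrow> (nat \<Rightarrow> 'x set) \<Rightarrow> (nat \<Rightarrow> 'x \<Rightarrow> 'x) \<Rightarrow>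
     (nat \<Rightarrow> 'x \<Rightarrow> 'c) \<Rightarrow> (nat \<Rightarrow> real) \<Rightarrow> real \<Rightarrow> real \<Rightarrow> bool" where
  "g_p_fusion_frame_bounds p X I Xs V P \<Lambda> v A B \<longleftrightarrow>
     g_p_fusion_family X I Xs V P \<Lambda> v \<and> 0 < A \<and> A \<le> B \<and>
     (\<forall>f\<in>carrier X.
        (\<lambda>i. v i powr p * vnorm (Xs i) (\<Lambda> i (P i f)) powr p) summable_on I \<and>
        A * vnorm X f
          \<le> (\<Sum>\<^sub>\<infinity>i\<in>I. v i powr p * vnorm (Xs i) (\<Lambda> i (P i f)) powr p) powr (1 / p) \<and>
        (\<Sum>\<^sub>\<infinity>i\<in>I. v i powr p * vnorm (Xs i) (\<Lambda> i (P i f)) powr p) powr (1 / p)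
          \<le> B * vnorm X f)"

definition g_p_fusion_frame ::
    "real \<Rightarrow> ('k::real_normed_field, 'x) normed_module \<Rightarrow> nat set \<Rightarrow>
     (nat \<Rightarrow> ('k, 'c) normed_module) \<Rightarrow> (nat \<Rightarrow> 'x set) \<Rightarrow> (nat \<Rightarrow> 'x \<Rightarrow> 'x) \<Rightarrow>
     (nat \<Rightarrow> 'x \<Rightarrow> 'c) \<Rightarrow> (nat \<Rightarrow> real) \<Rightarrow> bool" where
  "g_p_fusion_frame p X I Xs V P \<Lambda> v \<longleftrightarrow>
     (\<exists>A B. g_p_fusion_frame_bounds p X I Xs V P \<Lambda> v A B)"

definition direct_sum ::
    "real \<Rightarrow> ('k, 'x) normed_module \<Rightarrow> ('k, 'y) normed_module \<Rightarrow> ('k, 'x \<times> 'y) normed_module" where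
  "direct_sum p X Y =
     \<lparr>carrier = carrier X \<times> carrier Y,
      mult = (\<lambda>(a, b) (c, d). (a \<otimes>\<^bsub>X\<^esub> c, b \<otimes>\<^bsub>Y\<^esub> d)),
      one = (\<one>\<^bsub>X\<^esub>, \<one>\<^bsub>Y\<^esub>),
      zero = (\<zero>\<^bsub>X\<^esub>, \<zero>\<^bsub>Y\<^esub>),
      add = (\<lambda>(a, b) (c, d). (a \<oplus>\<^bsub>X\<^esub> c, b \<oplus>\<^bsub>Y\<^esub> d)),
      smult = (\<lambda>c (a, b). (c \<odot>\<^bsub>X\<^esub> a, c \<odot>\<^bsub>Y\<^esub> b)),
      vnorm = (\<lambda>(a, b). (vnorm X a powr p + vnorm Y b powr p) powr (1 / p))\<rparr>"

end

theory Submission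
  imports Defs
begin

text \<open>
  The sum of the \<open>p\<close>-th powers defining the frame inequality of the direct sum at \<open>(f, g)\<close> splits
  as \<open>S f + T g\<close>, because the \<open>p\<close>-th power of the norm of \<open>X\<^sub>i \<oplus> Y\<^sub>i\<close> is the sum of the \<open>p\<close>-th powers
  of the norms of the components.  The frame inequalities of the two summands, raised to the power
  \<open>p\<close>, read \<open>A\<^sup>p \<parallel>f\<parallel>\<^sup>p \<le> S f \<le> B\<^sup>p \<parallel>f\<parallel>\<^sup>p\<close> and \<open>C\<^sup>p \<parallel>g\<parallel>\<^sup>p \<le> T g \<le> D\<^sup>p \<parallel>g\<parallel>\<^sup>p\<close>; adding them and replacing
  the constants by their minimum and maximum gives the claimed bounds
  (\<open>direct_sum_frame_inequality\<close>).  Taking \<open>p\<close>-th roots gives the bounds \<open>min A C\<close> and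
  \<open>max B D\<close> for the direct sum.

  The remaining work is to see that the direct sum is again a family of the required kind.
  Minkowski's inequality for pairs makes the \<open>p\<close>-norm a norm (\<open>normed_space_direct_sum\<close>).  It
  lies between either component and the sum of the components, so its distance is equivalent to the
  Euclidean product distance.  Equivalent distances have the same topology and the same Cauchy
  sequences; hence the topology of the direct sum is the product topology, and completeness,
  separability and closedness of subspaces are inherited from the summands.
\<close>

section \<open>The p-norm of a pair of numbers\<close>

definition lp_pair :: "real \<Rightarrow> real \<Rightarrow> real \<Rightarrow> real" where
  "lp_pair p a b = (a powr p + b powr p) powr (1 / p)"

lemma lp_pair_nonneg [simp]: "0 \<le> lp_pair p a b"
  by (simp add: lp_pair_def)

lemma lp_pair_powr: "p \<noteq> 0 \<Longrightarrow> lp_pair p a b powr p = a powr p + b powr p"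
  by (simp add: lp_pair_def powr_powr)

lemma lp_pair_eq_0_iff:
  assumes "0 \<le> a" "0 \<le> b"
  shows "lp_pair p a b = 0 \<longleftrightarrow> a = 0 \<and> b = 0"
  using assms by (simp add: lp_pair_def add_nonneg_eq_0_iff)

lemma lp_pair_mult:
  assumes "p \<noteq> 0" "0 \<le> c" "0 \<le> a" "0 \<le> b"
  shows "lp_pair p (c * a) (c * b) = c * lp_pair p a b"
proof -
  have "(c * a) powr p + (c * b) powr p = c powr p * (a powr p + b powr p)"
    using assms by (simp add: powr_mult distrib_left)
  then show ?thesis
    using assms by (simp add: lp_pair_def powr_mult powr_powr)
qed

lemma lp_pair_mono:
  assumes "0 < p" "0 \<le> a" "a \<le> a'" "0 \<le> b" "b \<le> b'"
  shows "lp_pair p a b \<le> lp_pair p a' b'"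
  unfolding lp_pair_def using assms by (intro powr_mono2 add_mono) auto

lemma lp_pair_ge:
  assumes "0 < p" "0 \<le> a" "0 \<le> b"
  shows "a \<le> lp_pair p a b" "b \<le> lp_pair p a b"
  using lp_pair_mono[of p a a 0 b] lp_pair_mono[of p 0 a b b] assms
  by (simp_all add: lp_pair_def powr_powr)

text \<open>Convexity of \<open>x\<^sup>p\<close> on the closed half-line: at the end point \<open>0\<close> it amounts to \<open>t\<^sup>p \<le> t\<close>.\<close>

lemma powr_convex_nonneg:
  fixes p :: real
  assumes p: "1 \<le> p" and st: "0 < s" "0 < t" "s + t = 1" and xy: "0 \<le> x" "0 \<le> y"
  shows "(s * x + t * y) powr p \<le> s * x powr p + t * y powr p"
proof -
  have le: "(u * z) powr p \<le> u * z powr p" if "0 < u" "u \<le> 1" "0 \<le> z" for u z :: real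
  proof -
    have "u powr p \<le> u"
      using powr_mono'[of 1 p u] that p by simp
    then show ?thesis
      using that by (simp add: powr_mult mult_right_mono)
  qed
  consider "x = 0" | "y = 0" | "0 < x" "0 < y"
    using xy by linarith
  then show ?thesis
  proof cases
    case 3
    then show ?thesis
      using convex_onD[OF powr_convex[OF p], of t x y] st by (simp add: eq_diff_eq[symmetric])
  qed (use le[of t y] le[of s x] st xy p in auto)
qed

text \<open>
  Minkowski's inequality.  With \<open>S\<close> and \<open>T\<close> the two norms on the right, \<open>(a + c) / (S + T)\<close> is the
  convex combination of \<open>a / S\<close> and \<open>c / T\<close> with weights \<open>S / (S + T)\<close> and \<open>T / (S + T)\<close>, and
  likewise for \<open>b\<close> and \<open>d\<close>.  By convexity of \<open>x\<^sup>p\<close> the \<open>p\<close>-th powers of these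
  two quotients sum to at most \<open>1\<close>.
\<close>

lemma lp_pair_triangle:
  assumes p: "1 \<le> p" and nonneg: "0 \<le> a" "0 \<le> b" "0 \<le> c" "0 \<le> d"
  shows "lp_pair p (a + c) (b + d) \<le> lp_pair p a b + lp_pair p c d"
proof -
  define S T where "S = lp_pair p a b" and "T = lp_pair p c d"
  consider "S = 0" | "T = 0" | "0 < S" "0 < T"
    using lp_pair_nonneg[of p] unfolding S_def T_def by (metis less_eq_real_def)
  then show ?thesis
  proof cases
    case 1
    then show ?thesis using nonneg by (simp add: S_def lp_pair_eq_0_iff)
  next
    case 2
    then show ?thesis using nonneg by (simp add: T_def lp_pair_eq_0_iff)
  next
    case 3
    define s t where "s = S / (S + T)" and "t = T / (S + T)"
    have st: "0 < s" "0 < t" "s + t = 1"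
      using 3 by (simp_all add: s_def t_def add_divide_distrib[symmetric])
    have comb: "((x + y) / (S + T)) powr p \<le> s * (x / S) powr p + t * (y / T) powr p"
      if "0 \<le> x" "0 \<le> y" for x y
    proof -
      have "(x + y) / (S + T) = s * (x / S) + t * (y / T)"
        using 3 by (simp add: s_def t_def add_divide_distrib)
      then show ?thesis
        using powr_convex_nonneg[OF p st, of "x / S" "y / T"] that 3 by simp
    qed
    have unit: "(a / S) powr p + (b / S) powr p = 1" "(c / T) powr p + (d / T) powr p = 1"
      using 3 nonneg p lp_pair_powr[of p a b, folded S_def, symmetric]
        lp_pair_powr[of p c d, folded T_def, symmetric]
      by (simp_all add: powr_divide add_divide_distrib[symmetric])
    have "((a + c) / (S + T)) powr p + ((b + d) / (S + T)) powr p
        \<le> s * ((a / S) powr p + (b / S) powr p) + t * ((c / T) powr p + (d / T) powr p)"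
      using comb[of a c] comb[of b d] nonneg by (simp add: algebra_simps)
    also have "\<dots> = 1"
      using unit st by simp
    finally have "(a + c) powr p + (b + d) powr p \<le> (S + T) powr p"
      using 3 nonneg by (simp add: powr_divide add_divide_distrib[symmetric])
    then have "lp_pair p (a + c) (b + d) \<le> ((S + T) powr p) powr (1 / p)"
      unfolding lp_pair_def using p by (intro powr_mono2) auto
    then show ?thesis
      using 3 p by (simp add: powr_powr S_def T_def)
  qed
qed

lemma lp_pair_le_add:
  assumes "1 \<le> p" "0 \<le> a" "0 \<le> b"
  shows "lp_pair p a b \<le> a + b"
  using lp_pair_triangle[of p a 0 0 b] assms by (simp add: lp_pair_def powr_powr)

section \<open>Comparison of metrics\<close>

text \<open>
  If \<open>d \<le> K e\<close>, then the \<open>e\<close>-ball of radius \<open>r / K\<close> lies in the \<open>d\<close>-ball of radius \<open>r\<close>.  This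
  one-sided comparison is applied in both directions to equivalent metrics, for the topology here
  and for Cauchy sequences below.
\<close>

lemma mtopology_coarser:
  assumes d: "Metric_space M d" and e: "Metric_space M e"
    and K: "0 < K" "\<And>x y. x \<in> M \<Longrightarrow> y \<in> M \<Longrightarrow> d x y \<le> K * e x y"
    and U: "openin (Metric_space.mtopology M d) U"
  shows "openin (Metric_space.mtopology M e) U"
proof -
  interpret d: Metric_space M d by fact
  interpret e: Metric_space M e by fact
  have "\<exists>r>0. e.mball x r \<subseteq> U" if x: "x \<in> U" for x
  proof -
    obtain r where r: "0 < r" "d.mball x r \<subseteq> U"
      using U x unfolding d.openin_mtopology by blast
    have "e.mball x (r / K) \<subseteq> d.mball x r"
    proof
      fix y assume y: "y \<in> e.mball x (r / K)"
      then have "K * e x y < r"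
        using K(1) by (simp add: field_simps)
      with y K(2)[of x y] show "y \<in> d.mball x r"
        by auto
    qed
    with r K(1) show ?thesis
      by (meson divide_pos_pos order_trans)
  qed
  with U show ?thesis
    unfolding d.openin_mtopology e.openin_mtopology by blast
qed

lemma MCauchy_coarser:
  assumes d: "Metric_space M d" and e: "Metric_space M e"
    and K: "0 < K" "\<And>x y. x \<in> M \<Longrightarrow> y \<in> M \<Longrightarrow> d x y \<le> K * e x y"
    and \<sigma>: "Metric_space.MCauchy M e \<sigma>"
  shows "Metric_space.MCauchy M d \<sigma>"
proof -
  interpret d: Metric_space M d by fact
  interpret e: Metric_space M e by fact
  have ran: "range \<sigma> \<subseteq> M"
    using \<sigma> by (simp add: e.MCauchy_def)
  have "\<exists>N. \<forall>n n'. N \<le> n \<longrightarrow> N \<le> n' \<longrightarrow> d (\<sigma> n) (\<sigma> n') < r" if "0 < r" for r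
  proof -
    obtain N where N: "\<And>n n'. N \<le> n \<Longrightarrow> N \<le> n' \<Longrightarrow> e (\<sigma> n) (\<sigma> n') < r / K"
      using \<sigma> \<open>0 < r\<close> K(1) unfolding e.MCauchy_def by (meson divide_pos_pos)
    have "d (\<sigma> n) (\<sigma> n') < r" if "N \<le> n" "N \<le> n'" for n n'
    proof -
      have "d (\<sigma> n) (\<sigma> n') \<le> K * e (\<sigma> n) (\<sigma> n')"
        using ran by (intro K(2)) auto
      also have "\<dots> < r"
        using N[OF that] K(1) by (simp add: field_simps)
      finally show ?thesis .
    qed
    then show ?thesis by blast
  qed
  with ran show ?thesis
    by (simp add: d.MCauchy_def)
qed

lemma equivalent_metrics:
  assumes d: "Metric_space M d" and e: "Metric_space M e"
    and K: "0 < K" "\<And>x y. x \<in> M \<Longrightarrow> y \<in> M \<Longrightarrow> d x y \<le> K * e x y"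
    and L: "0 < L" "\<And>x y. x \<in> M \<Longrightarrow> y \<in> M \<Longrightarrow> e x y \<le> L * d x y"
  shows "Metric_space.mtopology M d = Metric_space.mtopology M e"
    and "Metric_space.mcomplete M d \<longleftrightarrow> Metric_space.mcomplete M e"
proof -
  show top: "Metric_space.mtopology M d = Metric_space.mtopology M e"
    unfolding topology_eq
    using mtopology_coarser[OF d e K] mtopology_coarser[OF e d L] by blast
  have "Metric_space.MCauchy M d \<sigma> \<longleftrightarrow> Metric_space.MCauchy M e \<sigma>" for \<sigma>
    using MCauchy_coarser[OF d e K] MCauchy_coarser[OF e d L] by blast
  then show "Metric_space.mcomplete M d \<longleftrightarrow> Metric_space.mcomplete M e"
    by (simp add: Metric_space.mcomplete_def[OF d] Metric_space.mcomplete_def[OF e] top)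
qed

lemma separable_space_prod_topology:
  assumes "separable_space S" "separable_space T"
  shows "separable_space (prod_topology S T)"
proof -
  obtain C D where "countable C" "C \<subseteq> topspace S" "S closure_of C = topspace S"
    "countable D" "D \<subseteq> topspace T" "T closure_of D = topspace T"
    using assms unfolding separable_space_def by blast
  then show ?thesis
    unfolding separable_space_def
    by (intro exI[of _ "C \<times> D"]) (auto simp: closure_of_Times)
qed

section \<open>The direct sum as a Banach space\<close>

lemma (in normed_space) vnorm_nonneg:
  assumes "x \<in> carrier X"
  shows "0 \<le> vnorm X x"
proof -
  interpret Metric_space "carrier X" "vdist X"
    by (rule Metric_space_vdist)
  have inv_zero: "\<ominus>\<^bsub>X\<^esub> \<zero>\<^bsub>X\<^esub> = \<zero>\<^bsub>X\<^esub>"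
    by (rule M.minus_equality) auto
  have "vdist X x \<zero>\<^bsub>X\<^esub> = vnorm X x"
    using assms by (simp add: vdist_def a_minus_def inv_zero)
  then show ?thesis
    by (metis nonneg)
qed

lemma direct_sum_simps [simp]:
  "carrier (direct_sum p X Y) = carrier X \<times> carrier Y"
  "\<zero>\<^bsub>direct_sum p X Y\<^esub> = (\<zero>\<^bsub>X\<^esub>, \<zero>\<^bsub>Y\<^esub>)"
  "(a, b) \<oplus>\<^bsub>direct_sum p X Y\<^esub> (c, d) = (a \<oplus>\<^bsub>X\<^esub> c, b \<oplus>\<^bsub>Y\<^esub> d)"
  "k \<odot>\<^bsub>direct_sum p X Y\<^esub> (a, b) = (k \<odot>\<^bsub>X\<^esub> a, k \<odot>\<^bsub>Y\<^esub> b)"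
  "vnorm (direct_sum p X Y) (a, b) = lp_pair p (vnorm X a) (vnorm Y b)"
  by (simp_all add: direct_sum_def lp_pair_def)

lemma module_direct_sum:
  assumes "module R X" "module R Y"
  shows "module R (direct_sum p X Y)"
proof -
  interpret X: module R X by fact
  interpret Y: module R Y by fact
  have "abelian_group (direct_sum p X Y)"
  proof (rule abelian_groupI)
    fix z assume "z \<in> carrier (direct_sum p X Y)"
    then obtain x y where z: "z = (x, y)" "x \<in> carrier X" "y \<in> carrier Y"
      by auto
    then show "\<exists>w\<in>carrier (direct_sum p X Y). w \<oplus>\<^bsub>direct_sum p X Y\<^esub> z = \<zero>\<^bsub>direct_sum p X Y\<^esub>"
      by (intro bexI[of _ "(\<ominus>\<^bsub>X\<^esub> x, \<ominus>\<^bsub>Y\<^esub> y)"]) (auto simp: X.M.l_neg Y.M.l_neg)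
  qed (auto simp: X.M.a_ac Y.M.a_ac)
  then show ?thesis
    by (intro moduleI X.R.is_cring)
      (auto simp: X.smult_l_distr X.smult_r_distr X.smult_assoc1
        Y.smult_l_distr Y.smult_r_distr Y.smult_assoc1)
qed

lemma normed_space_direct_sum:
  assumes p: "1 < p" and X: "normed_space X" and Y: "normed_space Y"
  shows "normed_space (direct_sum p X Y)"
proof -
  interpret X: normed_space X by fact
  interpret Y: normed_space Y by fact
  show ?thesis
  proof (intro normed_space.intro normed_space_axioms.intro)
    show "module scalars (direct_sum p X Y)"
      by (intro module_direct_sum X.module_axioms Y.module_axioms)
  next
    fix z assume "z \<in> carrier (direct_sum p X Y)"
    then show "vnorm (direct_sum p X Y) z = 0 \<longleftrightarrow> z = \<zero>\<^bsub>direct_sum p X Y\<^esub>"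
      by (auto simp: lp_pair_eq_0_iff X.vnorm_nonneg Y.vnorm_nonneg
          X.vnorm_eq_0_iff Y.vnorm_eq_0_iff)
  next
    fix z c assume "z \<in> carrier (direct_sum p X Y)"
    then show "vnorm (direct_sum p X Y) (c \<odot>\<^bsub>direct_sum p X Y\<^esub> z)
        = norm c * vnorm (direct_sum p X Y) z"
      using p by (auto simp: X.vnorm_smult Y.vnorm_smult lp_pair_mult
          X.vnorm_nonneg Y.vnorm_nonneg)
  next
    fix z w assume "z \<in> carrier (direct_sum p X Y)" "w \<in> carrier (direct_sum p X Y)"
    then obtain a b c d where zw: "z = (a, b)" "w = (c, d)"
      and carr: "a \<in> carrier X" "c \<in> carrier X" "b \<in> carrier Y" "d \<in> carrier Y"
      by auto
    have "lp_pair p (vnorm X (a \<oplus>\<^bsub>X\<^esub> c)) (vnorm Y (b \<oplus>\<^bsub>Y\<^esub> d))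
        \<le> lp_pair p (vnorm X a + vnorm X c) (vnorm Y b + vnorm Y d)"
      using p carr
      by (intro lp_pair_mono) (auto simp: X.vnorm_triangle Y.vnorm_triangle
          X.vnorm_nonneg Y.vnorm_nonneg)
    also have "\<dots> \<le> lp_pair p (vnorm X a) (vnorm Y b) + lp_pair p (vnorm X c) (vnorm Y d)"
      using p carr by (intro lp_pair_triangle) (auto simp: X.vnorm_nonneg Y.vnorm_nonneg)
    finally show "vnorm (direct_sum p X Y) (z \<oplus>\<^bsub>direct_sum p X Y\<^esub> w)
        \<le> vnorm (direct_sum p X Y) z + vnorm (direct_sum p X Y) w"
      by (simp add: zw)
  qed
qed

lemma vdist_direct_sum:
  assumes X: "normed_space X" and Y: "normed_space Y" and p: "1 < p"
    and carr: "a \<in> carrier X" "c \<in> carrier X" "b \<in> carrier Y" "d \<in> carrier Y"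
  shows "vdist (direct_sum p X Y) (a, b) (c, d) = lp_pair p (vdist X a c) (vdist Y b d)"
proof -
  interpret X: normed_space X by fact
  interpret Y: normed_space Y by fact
  interpret Z: normed_space "direct_sum p X Y"
    by (intro normed_space_direct_sum p X Y)
  have "\<ominus>\<^bsub>direct_sum p X Y\<^esub> (c, d) = (\<ominus>\<^bsub>X\<^esub> c, \<ominus>\<^bsub>Y\<^esub> d)"
    using carr by (intro Z.M.minus_equality) (auto simp: X.M.l_neg Y.M.l_neg)
  then show ?thesis
    using carr by (simp add: vdist_def a_minus_def)
qed

text \<open>
  The \<open>p\<close>-norm distance and the Euclidean product distance both lie between the larger
  component and the sum of the two components, so they are equivalent with constants \<open>2\<close>.
\<close>

lemma
  assumes p: "1 < p" and X: "normed_space X" and Y: "normed_space Y"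
  shows vtopology_direct_sum:
      "vtopology (direct_sum p X Y) = prod_topology (vtopology X) (vtopology Y)" (is ?top)
    and mcomplete_direct_sum:
      "\<lbrakk>Metric_space.mcomplete (carrier X) (vdist X); Metric_space.mcomplete (carrier Y) (vdist Y)\<rbrakk>
        \<Longrightarrow> Metric_space.mcomplete (carrier (direct_sum p X Y)) (vdist (direct_sum p X Y))"
      (is "\<lbrakk>?cX; ?cY\<rbrakk> \<Longrightarrow> ?cZ")
proof -
  interpret Metric_space12 "carrier X" "vdist X" "carrier Y" "vdist Y"
    by (intro Metric_space12.intro normed_space.Metric_space_vdist X Y)
  let ?Z = "direct_sum p X Y" and ?e = "prod_dist (vdist X) (vdist Y)"
  have Z: "Metric_space (carrier X \<times> carrier Y) (vdist ?Z)"
    using normed_space.Metric_space_vdist[OF normed_space_direct_sum[OF p X Y]] by simp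
  have upper: "vdist ?Z z w \<le> 2 * ?e z w" and lower: "?e z w \<le> 2 * vdist ?Z z w"
    if zw: "z \<in> carrier X \<times> carrier Y" "w \<in> carrier X \<times> carrier Y" for z w
  proof -
    obtain a b c d where eq: "z = (a, b)" "w = (c, d)"
      and carr: "a \<in> carrier X" "c \<in> carrier X" "b \<in> carrier Y" "d \<in> carrier Y"
      using zw by auto
    have Zd: "vdist ?Z z w = lp_pair p (vdist X a c) (vdist Y b d)"
      unfolding eq by (rule vdist_direct_sum[OF X Y p carr])
    have ge: "vdist X a c \<le> ?e z w" "vdist Y b d \<le> ?e z w"
      unfolding eq by (rule component_le_prod_metric)+
    have le: "?e z w \<le> vdist X a c + vdist Y b d"
      unfolding eq by (rule prod_metric_le_components) (use carr in auto)
    show "vdist ?Z z w \<le> 2 * ?e z w"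
      using lp_pair_le_add[of p "vdist X a c" "vdist Y b d"] ge p by (simp add: Zd)
    show "?e z w \<le> 2 * vdist ?Z z w"
      using lp_pair_ge[of p "vdist X a c" "vdist Y b d"] le p by (simp add: Zd)
  qed
  note eqv = equivalent_metrics[OF Z prod_metric, where K = 2 and L = 2, OF _ upper _ lower, simplified]
  show ?top
    using eqv(1) mtopology_prod_metric by simp
  show ?cZ if ?cX ?cY
    using eqv(2) that mcomplete_prod_metric by simp
qed

lemma banach_space_direct_sum:
  assumes "1 < p" "banach_space X" "banach_space Y"
  shows "banach_space (direct_sum p X Y)"
  using assms normed_space_direct_sum mcomplete_direct_sum unfolding banach_space_def by blast

section \<open>Subspaces and operators on the direct sum\<close>

lemma submodule_direct_sum:
  assumes "module R X" "module R Y" and V: "submodule V R X" and W: "submodule W R Y"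
  shows "submodule (V \<times> W) R (direct_sum p X Y)"
proof -
  interpret X: module R X by fact
  interpret Y: module R Y by fact
  interpret Z: module R "direct_sum p X Y"
    by (intro module_direct_sum assms)
  note VE = X.submoduleE[OF V] and WE = Y.submoduleE[OF W]
  have minus: "\<ominus>\<^bsub>direct_sum p X Y\<^esub> (x, y) = (\<ominus>\<^bsub>X\<^esub> x, \<ominus>\<^bsub>Y\<^esub> y)" if "x \<in> V" "y \<in> W" for x y
    using that VE(1) WE(1) by (intro Z.M.minus_equality) (auto simp: X.M.l_neg Y.M.l_neg)
  show ?thesis
  proof (rule Z.submoduleI)
    show "V \<times> W \<subseteq> carrier (direct_sum p X Y)"
      using VE(1) WE(1) by auto
    show "\<zero>\<^bsub>direct_sum p X Y\<^esub> \<in> V \<times> W"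
      using V W by (simp add: submodule_def subgroup.one_closed[of _ "add_monoid _", simplified])
  qed (auto simp: minus VE WE)
qed

lemma closed_subspace_direct_sum:
  assumes p: "1 < p" and X: "normed_space X" and Y: "normed_space Y"
    and V: "closed_subspace X V" and W: "closed_subspace Y W"
  shows "closed_subspace (direct_sum p X Y) (V \<times> W)"
  using V W submodule_direct_sum[OF normed_space.axioms(1)[OF X] normed_space.axioms(1)[OF Y]]
  by (simp add: closed_subspace_def vtopology_direct_sum[OF p X Y] closedin_prod_Times_iff
      del: direct_sum_simps)

lemma linear_map_direct_sum:
  assumes "linear_map X X' S" "linear_map Y Y' T"
  shows "linear_map (direct_sum p X Y) (direct_sum p X' Y') (map_prod S T)"
  using assms by (auto simp: linear_map_def hom_def)

text \<open>
  Passing through the sum of the two component norms makes \<open>\<bar>K\<bar> + \<bar>L\<bar>\<close> a bound; the absolute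
  values are there because bounds of operators may be negative when the space is trivial.
\<close>

lemma bounded_operators_direct_sum:
  assumes p: "1 < p" and X: "normed_space X" and Y: "normed_space Y"
    and X': "normed_space X'" and Y': "normed_space Y'"
    and S: "S \<in> bounded_operators X X'" and T: "T \<in> bounded_operators Y Y'"
  shows "map_prod S T \<in> bounded_operators (direct_sum p X Y) (direct_sum p X' Y')"
proof -
  interpret X: normed_space X by fact
  interpret Y: normed_space Y by fact
  interpret X': normed_space X' by fact
  interpret Y': normed_space Y' by fact
  obtain K L where K: "\<And>x. x \<in> carrier X \<Longrightarrow> vnorm X' (S x) \<le> K * vnorm X x"
    and L: "\<And>y. y \<in> carrier Y \<Longrightarrow> vnorm Y' (T y) \<le> L * vnorm Y y"
    and lin: "linear_map X X' S" "linear_map Y Y' T"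
    using S T by (auto simp: bounded_operators_def)
  have "lp_pair p (vnorm X' (S x)) (vnorm Y' (T y))
      \<le> (\<bar>K\<bar> + \<bar>L\<bar>) * lp_pair p (vnorm X x) (vnorm Y y)"
    if x: "x \<in> carrier X" and y: "y \<in> carrier Y" for x y
  proof -
    have "S x \<in> carrier X'" "T y \<in> carrier Y'"
      using lin x y by (auto simp: linear_map_def hom_def)
    then have "lp_pair p (vnorm X' (S x)) (vnorm Y' (T y)) \<le> vnorm X' (S x) + vnorm Y' (T y)"
      using p by (intro lp_pair_le_add) (auto simp: X'.vnorm_nonneg Y'.vnorm_nonneg)
    also have "\<dots> \<le> \<bar>K\<bar> * vnorm X x + \<bar>L\<bar> * vnorm Y y"
      using K[OF x] L[OF y] x y
      by (intro add_mono; elim order_trans) (auto intro!: mult_right_mono X.vnorm_nonneg Y.vnorm_nonneg)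
    also have "\<dots> \<le> \<bar>K\<bar> * lp_pair p (vnorm X x) (vnorm Y y)
        + \<bar>L\<bar> * lp_pair p (vnorm X x) (vnorm Y y)"
      using p x y
      by (intro add_mono mult_left_mono lp_pair_ge) (auto simp: X.vnorm_nonneg Y.vnorm_nonneg)
    finally show ?thesis
      by (simp add: distrib_right)
  qed
  with lin show ?thesis
    by (auto simp: bounded_operators_def intro!: linear_map_direct_sum exI[of _ "\<bar>K\<bar> + \<bar>L\<bar>"])
qed

lemma projection_onto_direct_sum:
  assumes "projection_onto X V P" "projection_onto Y W Q"
  shows "projection_onto (direct_sum p X Y) (V \<times> W) (map_prod P Q)"
  using assms by (auto simp: projection_onto_def linear_map_direct_sum)

lemma g_p_fusion_family_direct_sum:
  assumes p: "1 < p"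
    and X: "g_p_fusion_family X I Xs V P \<Lambda> v" and Y: "g_p_fusion_family Y I Ys W Q \<Gamma> v"
  shows "g_p_fusion_family (direct_sum p X Y) I (\<lambda>i. direct_sum p (Xs i) (Ys i))
           (\<lambda>i. V i \<times> W i) (\<lambda>i. map_prod (P i) (Q i)) (\<lambda>i. map_prod (\<Lambda> i) (\<Gamma> i)) v"
proof -
  have ban: "banach_space X" "banach_space Y"
    and sep: "separable_space (vtopology X)" "separable_space (vtopology Y)"
    using X Y by (auto simp: g_p_fusion_family_def)
  then have ns: "normed_space X" "normed_space Y"
    by (auto simp: banach_space_def)
  interpret Y: normed_space Y by fact
  have "\<exists>z\<in>carrier (direct_sum p X Y). map_prod (P i) (Q i) z \<noteq> \<zero>\<^bsub>direct_sum p X Y\<^esub>"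
    if "i \<in> I" for i
  proof -
    obtain x where "x \<in> carrier X" "P i x \<noteq> \<zero>\<^bsub>X\<^esub>"
      using X \<open>i \<in> I\<close> unfolding g_p_fusion_family_def by blast
    then show ?thesis
      by (intro bexI[of _ "(x, \<zero>\<^bsub>Y\<^esub>)"]) auto
  qed
  moreover have "separable_space (vtopology (direct_sum p X Y))"
    using sep by (simp only: vtopology_direct_sum[OF p ns] separable_space_prod_topology)
  moreover have "normed_space (Xs i)" "normed_space (Ys i)" if "i \<in> I" for i
    using X Y that by (auto simp: g_p_fusion_family_def banach_space_def)
  ultimately show ?thesis
    using X Y p ban ns unfolding g_p_fusion_family_def
    by (simp add: banach_space_direct_sum closed_subspace_direct_sum
        projection_onto_direct_sum bounded_operators_direct_sum del: direct_sum_simps)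
qed

section \<open>The frame inequalities\<close>

text \<open>
  The frame condition is stated with \<open>p\<close>-th roots, the inequality to be proved with \<open>p\<close>-th powers;
  only the latter is additive over the summands.
\<close>

lemma powr_frame_bounds:
  fixes p :: real
  assumes p: "0 < p" and "0 \<le> A" "0 \<le> B" "0 \<le> n" "0 \<le> S"
  shows "A * n \<le> S powr (1 / p) \<longleftrightarrow> A powr p * n powr p \<le> S"
    and "S powr (1 / p) \<le> B * n \<longleftrightarrow> S \<le> B powr p * n powr p"
proof -
  have root: "S = (S powr (1 / p)) powr p"
    using assms by (simp add: powr_powr)
  have le_iff: "x \<le> y \<longleftrightarrow> x powr p \<le> y powr p" if "0 \<le> x" "0 \<le> y" for x y :: real
    using that p by (meson less_eq_real_def not_le powr_less_mono2 powr_mono2)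
  show "A * n \<le> S powr (1 / p) \<longleftrightarrow> A powr p * n powr p \<le> S"
    using le_iff[of "A * n" "S powr (1 / p)"] root assms by (simp add: powr_mult)
  show "S powr (1 / p) \<le> B * n \<longleftrightarrow> S \<le> B powr p * n powr p"
    using le_iff[of "S powr (1 / p)" "B * n"] root assms by (simp add: powr_mult)
qed

lemma direct_sum_frame_inequality:
  fixes X :: "('k::real_normed_field, 'x) normed_module"
    and Y :: "('k, 'y) normed_module"
    and Xs :: "nat \<Rightarrow> ('k, 'c) normed_module"
    and Ys :: "nat \<Rightarrow> ('k, 'd) normed_module"
  assumes p: "1 < p"
    and X: "g_p_fusion_frame_bounds p X I Xs V P \<Lambda> v A B"
    and Y: "g_p_fusion_frame_bounds p Y I Ys W Q \<Gamma> v C D"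
    and f: "f \<in> carrier X" and g: "g \<in> carrier Y"
  defines "F \<equiv> \<lambda>i. v i powr p * vnorm (direct_sum p (Xs i) (Ys i))
                (map_prod (\<Lambda> i) (\<Gamma> i) (map_prod (P i) (Q i) (f, g))) powr p"
    and "n \<equiv> vnorm (direct_sum p X Y) (f, g) powr p"
  shows "F summable_on I"
    and "min (A powr p) (C powr p) * n \<le> infsum F I"
    and "infsum F I \<le> max (B powr p) (D powr p) * n"
proof -
  define S where "S = (\<lambda>i. v i powr p * vnorm (Xs i) (\<Lambda> i (P i f)) powr p)"
  define T where "T = (\<lambda>i. v i powr p * vnorm (Ys i) (\<Gamma> i (Q i g)) powr p)"
  have n: "n = vnorm X f powr p + vnorm Y g powr p"
    using p by (simp add: n_def lp_pair_powr)
  have F: "F = (\<lambda>i. S i + T i)"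
    using p by (simp add: F_def S_def T_def lp_pair_powr distrib_left)
  have sum: "S summable_on I" "T summable_on I"
    using X Y f g by (auto simp: g_p_fusion_frame_bounds_def S_def T_def)
  then show "F summable_on I"
    unfolding F by (rule summable_on_add)
  have FST: "infsum F I = infsum S I + infsum T I"
    unfolding F using sum by (rule infsum_add)
  have nonneg: "0 \<le> infsum S I" "0 \<le> infsum T I"
    by (auto intro!: infsum_nonneg simp: S_def T_def)
  have "normed_space X" "normed_space Y"
    using X Y by (auto simp: g_p_fusion_frame_bounds_def g_p_fusion_family_def banach_space_def)
  then have norm: "0 \<le> vnorm X f" "0 \<le> vnorm Y g"
    using f g by (auto intro: normed_space.vnorm_nonneg)
  have "0 < A" "A \<le> B" "A * vnorm X f \<le> infsum S I powr (1 / p)"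
    "infsum S I powr (1 / p) \<le> B * vnorm X f"
    using X f by (auto simp: g_p_fusion_frame_bounds_def S_def)
  then have boundS: "A powr p * vnorm X f powr p \<le> infsum S I"
    "infsum S I \<le> B powr p * vnorm X f powr p"
    using powr_frame_bounds[of p A B "vnorm X f" "infsum S I"] p norm nonneg by auto
  have "0 < C" "C \<le> D" "C * vnorm Y g \<le> infsum T I powr (1 / p)"
    "infsum T I powr (1 / p) \<le> D * vnorm Y g"
    using Y g by (auto simp: g_p_fusion_frame_bounds_def T_def)
  then have boundT: "C powr p * vnorm Y g powr p \<le> infsum T I"
    "infsum T I \<le> D powr p * vnorm Y g powr p"
    using powr_frame_bounds[of p C D "vnorm Y g" "infsum T I"] p norm nonneg by auto
  have "min (A powr p) (C powr p) * n
      \<le> A powr p * vnorm X f powr p + C powr p * vnorm Y g powr p"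
    unfolding n distrib_left by (intro add_mono mult_right_mono) auto
  then show "min (A powr p) (C powr p) * n \<le> infsum F I"
    using boundS boundT FST by linarith
  have "B powr p * vnorm X f powr p + D powr p * vnorm Y g powr p
      \<le> max (B powr p) (D powr p) * n"
    unfolding n distrib_left by (intro add_mono mult_right_mono) auto
  then show "infsum F I \<le> max (B powr p) (D powr p) * n"
    using boundS boundT FST by linarith
qed

lemma g_p_fusion_frame_bounds_direct_sum:
  assumes p: "1 < p"
    and X: "g_p_fusion_frame_bounds p X I Xs V P \<Lambda> v A B"
    and Y: "g_p_fusion_frame_bounds p Y I Ys W Q \<Gamma> v C D"
  shows "g_p_fusion_frame_bounds p (direct_sum p X Y) I (\<lambda>i. direct_sum p (Xs i) (Ys i))
           (\<lambda>i. V i \<times> W i) (\<lambda>i. map_prod (P i) (Q i)) (\<lambda>i. map_prod (\<Lambda> i) (\<Gamma> i)) v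
           (min A C) (max B D)"
proof -
  have AB: "0 < A" "A \<le> B" and CD: "0 < C" "C \<le> D"
    using X Y by (auto simp: g_p_fusion_frame_bounds_def)
  \<comment> \<open>Since \<open>x\<^sup>p\<close> is increasing, the minimum and maximum commute with powers.\<close>
  have "mono_on {0..} (\<lambda>x. x powr p)"
    using p by (intro mono_onI powr_mono2) auto
  then have minmax: "min A C powr p = min (A powr p) (C powr p)"
    "max B D powr p = max (B powr p) (D powr p)"
    using AB CD p by (auto simp: min_def max_def mono_on_def intro: antisym)
  have family: "g_p_fusion_family (direct_sum p X Y) I (\<lambda>i. direct_sum p (Xs i) (Ys i))
      (\<lambda>i. V i \<times> W i) (\<lambda>i. map_prod (P i) (Q i)) (\<lambda>i. map_prod (\<Lambda> i) (\<Gamma> i)) v"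
    using X Y p by (intro g_p_fusion_family_direct_sum) (auto simp: g_p_fusion_frame_bounds_def)
  show ?thesis
    unfolding g_p_fusion_frame_bounds_def
  proof (intro conjI ballI)
    fix z assume "z \<in> carrier (direct_sum p X Y)"
    then obtain f g where z: "z = (f, g)" and fg: "f \<in> carrier X" "g \<in> carrier Y"
      by auto
    let ?F = "\<lambda>i. v i powr p * vnorm (direct_sum p (Xs i) (Ys i))
        (map_prod (\<Lambda> i) (\<Gamma> i) (map_prod (P i) (Q i) z)) powr p"
    note ineq = direct_sum_frame_inequality[OF p X Y fg, folded z]
    show "?F summable_on I"
      by (rule ineq(1))
    have "0 \<le> infsum ?F I"
      by (intro infsum_nonneg) auto
    note iffs = powr_frame_bounds[OF _ _ _ _ this, of p "min A C" "max B D" "vnorm (direct_sum p X Y) z"]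
    have nn: "0 \<le> vnorm (direct_sum p X Y) z"
      by (simp add: z)
    show "min A C * vnorm (direct_sum p X Y) z \<le> infsum ?F I powr (1 / p)"
      using ineq(2) AB CD p nn by (subst iffs(1)) (auto simp: minmax)
    show "infsum ?F I powr (1 / p) \<le> max B D * vnorm (direct_sum p X Y) z"
      using ineq(3) AB CD p nn by (subst iffs(2)) (auto simp: minmax)
  qed (use AB CD family in auto)
qed

theorem theorem4p3:
  fixes p A B C D :: real
    and I :: "nat set"
    and X :: "('k::real_normed_field, 'x) normed_module"
    and Y :: "('k, 'y) normed_module"
    and Xs :: "nat \<Rightarrow> ('k, 'c) normed_module"
    and Ys :: "nat \<Rightarrow> ('k, 'd) normed_module"
    and V :: "nat \<Rightarrow> 'x set" and W :: "nat \<Rightarrow> 'y set"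
    and P :: "nat \<Rightarrow> 'x \<Rightarrow> 'x" and Q :: "nat \<Rightarrow> 'y \<Rightarrow> 'y"
    and \<Lambda> :: "nat \<Rightarrow> 'x \<Rightarrow> 'c" and \<Gamma> :: "nat \<Rightarrow> 'y \<Rightarrow> 'd"
    and v :: "nat \<Rightarrow> real"
  assumes "1 < p"
    and "g_p_fusion_frame_bounds p X I Xs V P \<Lambda> v A B"
    and "g_p_fusion_frame_bounds p Y I Ys W Q \<Gamma> v C D"
  shows "g_p_fusion_frame p (direct_sum p X Y) I (\<lambda>i. direct_sum p (Xs i) (Ys i))
           (\<lambda>i. V i \<times> W i) (\<lambda>i. map_prod (P i) (Q i)) (\<lambda>i. map_prod (\<Lambda> i) (\<Gamma> i)) v \<and>
         (\<forall>f\<in>carrier X. \<forall>g\<in>carrier Y.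
           min (A powr p) (C powr p) * vnorm (direct_sum p X Y) (f, g) powr p
             \<le> (\<Sum>\<^sub>\<infinity>i\<in>I. v i powr p *
                  vnorm (direct_sum p (Xs i) (Ys i))
                    (map_prod (\<Lambda> i) (\<Gamma> i) (map_prod (P i) (Q i) (f, g))) powr p) \<and>
           (\<Sum>\<^sub>\<infinity>i\<in>I. v i powr p *
                  vnorm (direct_sum p (Xs i) (Ys i))
                    (map_prod (\<Lambda> i) (\<Gamma> i) (map_prod (P i) (Q i) (f, g))) powr p)
             \<le> max (B powr p) (D powr p) * vnorm (direct_sum p X Y) (f, g) powr p)"
  using g_p_fusion_frame_bounds_direct_sum[OF assms] direct_sum_frame_inequality(2,3)[OF assms]
  unfolding g_p_fusion_frame_def by blast

end
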